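(* Let $L>0$, let $f:\mathbb{R}^d\to\mathbb{R}$ be convex and $L$-smooth, and let $x^\star$ be a minimizer of $f$, with $f^\star=f(x^\star)$. Fix the total iteration count $K\ge 1$, and set $A_k=\left(1+\frac{k}{6K^{1/3}}\right)^2$ for $0\le k\le K$. Independently sample $u_k\sim\operatorname{Unif}(A_k,A_{k+1})$ for $0\le k<K$, and set $u_K=A_K$. Put $$\delta_k=\frac1{u_k}-\frac1{u_{k+1}},\qquad \eta_k=\frac{(A_{k+1}-A_k)\,u_k\,\delta_k}{L}\quad(0\le k<K),\qquad \beta_k=\frac{\delta_k}{\delta_{k-1}}\quad(1\le k<K),\qquad \beta_0=0$$ (all $\delta_k$ are positive almost surely). Then, for any starting point $x^0\in\mathbb{R}^d$, the heavy-ball iterates $$x^{k+1}=x^k-\eta_k\nabla f(x^k)+\beta_k(x^k-x^{k-1}),\quad 0\le k<K,\qquad x^{-1}=x^0,$$ satisfy $$\mathbb{E}[f(x^K)-f^\star]\le\frac{36\,\mathrm{e}^{1/7}L\|x^0-x^\star\|^2}{K^{4/3}}.$$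
   Context: $\|\cdot\|$ is the Euclidean norm on $\mathbb{R}^d$. A function $f$ is $L$-smooth if it is differentiable and $\|\nabla f(x)-\nabla f(y)\|\le L\|x-y\|$ for all $x,y\in\mathbb{R}^d$. The starting point $x^0$ is deterministic and the gradient oracle is exact; the only randomness is in the sampled times $u_0,\dots,u_{K-1}$. *)

theory Defs
  imports "HOL-Probability.Probability"
begin

definition grad :: "('a::euclidean_space \<Rightarrow> real) \<Rightarrow> 'a \<Rightarrow> 'a" where
  "grad f x = (THE D. GDERIV f x :> D)"

definition L_smooth :: "real \<Rightarrow> ('a::euclidean_space \<Rightarrow> real) \<Rightarrow> bool" where
  "L_smooth L f \<longleftrightarrow> (\<forall>x. f differentiable (at x)) \<and>
     (\<forall>x y. norm (grad f x - grad f y) \<le> L * norm (x - y))"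

definition grid :: "nat \<Rightarrow> nat \<Rightarrow> real" where
  "grid K k = (1 + real k / (6 * real K powr (1/3)))\<^sup>2"

definition hb_delta :: "(nat \<Rightarrow> real) \<Rightarrow> nat \<Rightarrow> real" where
  "hb_delta u k = 1 / u k - 1 / u (Suc k)"

definition hb_eta :: "real \<Rightarrow> (nat \<Rightarrow> real) \<Rightarrow> (nat \<Rightarrow> real) \<Rightarrow> nat \<Rightarrow> real" where
  "hb_eta L A u k = (A (Suc k) - A k) * u k * hb_delta u k / L"

definition hb_beta :: "(nat \<Rightarrow> real) \<Rightarrow> nat \<Rightarrow> real" where
  "hb_beta u k = (if k = 0 then 0 else hb_delta u k / hb_delta u (k - 1))"

(* Truncated subtraction on nat makes "k - 1" equal to 0 for k = 0,
   which is exactly the convention x^{-1} = x^0. *)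
fun heavy_ball ::
  "(nat \<Rightarrow> real) \<Rightarrow> (nat \<Rightarrow> real) \<Rightarrow> ('a \<Rightarrow> 'a) \<Rightarrow> 'a \<Rightarrow> nat \<Rightarrow> 'a::real_vector" where
  "heavy_ball \<eta> \<beta> g x0 0 = x0"
| "heavy_ball \<eta> \<beta> g x0 (Suc k) =
     heavy_ball \<eta> \<beta> g x0 k - \<eta> k *\<^sub>R g (heavy_ball \<eta> \<beta> g x0 k)
       + \<beta> k *\<^sub>R (heavy_ball \<eta> \<beta> g x0 k - heavy_ball \<eta> \<beta> g x0 (k - 1))"

end

theory Submission
  imports Defs
begin

text \<open>
  Heavy ball is an accelerated method in disguise: with \<open>a = A (k+1) - A k\<close> and
  \<open>z' = z - (a / L) \<nabla>f x\<close>, the iterate \<open>x\<close> is the point at time \<open>u k\<close> of the curve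
  \<open>X t = z - (A k / t) (z - y)\<close>, which starts at \<open>y\<close> at time \<open>A k\<close> and satisfies \<open>(t X)' = z\<close>. By
  convexity and smoothness,
  \<open>(t (f (X t) - f*))' \<le> <\<nabla>f (X t), z - x*> - |\<nabla>f (X t)|^2 / (2L)\<close>,
  and averaging the mirror-descent identity for \<open>|z' - x*|^2\<close> over the uniform time \<open>u k\<close> gives exactly
  the integral of the right-hand side, without discretisation error. The excess term
  \<open>a^2 |\<nabla>f|^2 / (2L)\<close> is compensated by the jump from \<open>X (A (k+1))\<close> to the new \<open>y\<close>, which is a
  gradient step of mean size \<open>a^2 / (2 L A (k+1))\<close>. What remains is a higher-order multiple of \<open>|z - y|^2\<close>, so the expected Lyapunov function
  \<open>A k (f y - f*) + (L / 2) |z - x*|^2\<close> grows by at most \<open>1 + 1 / (7 K)\<close> per step.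
\<close>

section \<open>Existence and uniqueness of the gradient\<close>

text \<open>Because \<open>grad\<close> is a definite description, a gradient must be exhibited and
  shown unique. Expanding the derivative in the orthonormal basis gives the Riesz vector
  \<open>D\<close>.\<close>

lemma differentiable_imp_gderiv_grad:
  fixes f :: "'a::euclidean_space \<Rightarrow> real"
  assumes "f differentiable (at x)"
  shows "GDERIV f x :> grad f x"
proof -
  obtain f' where f': "(f has_derivative f') (at x)"
    using assms unfolding differentiable_def by blast
  interpret f': bounded_linear f' by (rule has_derivative_bounded_linear[OF f'])
  define D where "D = (\<Sum>b\<in>Basis. f' b *\<^sub>R b)"
  have eq: "f' h = inner h D" for h
  proof -
    have "inner h D = (\<Sum>b\<in>Basis. f' (inner h b *\<^sub>R b))"
      unfolding D_def inner_sum_right inner_scaleR_right f'.scaleR by (simp add: mult.commute)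
    also have "\<dots> = f' h"
      unfolding f'.sum[symmetric] euclidean_representation ..
    finally show ?thesis ..
  qed
  have D: "GDERIV f x :> D"
    using f' unfolding gderiv_def eq[abs_def] .
  have "E = D" if "GDERIV f x :> E" for E
  proof -
    have eqf: "(\<lambda>h. inner h E) = (\<lambda>h. inner h D)"
      using that D unfolding gderiv_def by (rule has_derivative_unique)
    have "inner E h = inner D h" for h
      using fun_cong[OF eqf, of h] inner_commute[of E h] inner_commute[of D h] by simp
    then show ?thesis by (rule euclidean_eqI)
  qed
  then have "grad f x = D"
    unfolding grad_def using D by (intro the_equality)
  then show ?thesis using D by simp
qed

section \<open>Heavy ball rewritten as a two-sequence method\<close>

text \<open>A state is a pair \<open>(y, z)\<close>; \<open>hb_point \<alpha> (y, z)\<close> is the curve \<open>X\<close> with \<open>X \<alpha> = y\<close>.\<close>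

definition hb_point :: "real \<Rightarrow> 'a \<times> 'a \<Rightarrow> real \<Rightarrow> 'a::real_vector" where
  "hb_point \<alpha> s t = snd s - (\<alpha> / t) *\<^sub>R (snd s - fst s)"

text \<open>The gradient coefficient of the first component is chosen so that, multiplied by
  \<open>b\<close>, it is \<open>b - u\<close> times the coefficient of the second. Both
  \<open>hb_step_momentum\<close> and \<open>hb_step_weighted_average\<close> rest on this
  proportion.\<close>

definition hb_step ::
  "real \<Rightarrow> ('a \<Rightarrow> 'a) \<Rightarrow> real \<Rightarrow> real \<Rightarrow> 'a \<times> 'a \<Rightarrow> real \<Rightarrow> 'a::real_vector \<times> 'a" where
  "hb_step L g \<alpha> b s u =
     (hb_point \<alpha> s b - ((b - \<alpha>) * (b - u) / (L * b)) *\<^sub>R g (hb_point \<alpha> s u),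
      snd s - ((b - \<alpha>) / L) *\<^sub>R g (hb_point \<alpha> s u))"

primrec hb_state ::
  "real \<Rightarrow> ('a \<Rightarrow> 'a) \<Rightarrow> (nat \<Rightarrow> real) \<Rightarrow> 'a \<Rightarrow> (nat \<Rightarrow> real) \<Rightarrow> nat \<Rightarrow> 'a::real_vector \<times> 'a" where
  "hb_state L g A x0 u 0 = (x0, x0)"
| "hb_state L g A x0 u (Suc k) = hb_step L g (A k) (A (Suc k)) (hb_state L g A x0 u k) (u k)"

lemma hb_state_cong:
  assumes "\<And>i. i < k \<Longrightarrow> u i = v i"
  shows "hb_state L g A x0 u k = hb_state L g A x0 v k"
  using assms by (induction k) auto

text \<open>Multiplied by \<open>b\<close>, the gradient coefficients of the two components differ
  by \<open>(b - \<alpha>) * u / L\<close>, which is where the factor \<open>u k\<close> of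
  \<open>hb_eta\<close> comes from. The gap between the components, scaled by time, thus plays the
  role of a momentum.\<close>

lemma hb_step_momentum:
  assumes "b \<noteq> 0" and "L \<noteq> 0" and "\<alpha> \<noteq> 0"
  shows "b *\<^sub>R (snd (hb_step L g \<alpha> b s u) - fst (hb_step L g \<alpha> b s u)) =
    \<alpha> *\<^sub>R (snd s - fst s) - ((b - \<alpha>) * u / L) *\<^sub>R g (hb_point \<alpha> s u)"
proof -
  define G where "G = g (hb_point \<alpha> s u)"
  have "b *\<^sub>R (snd (hb_step L g \<alpha> b s u) - fst (hb_step L g \<alpha> b s u)) =
      (b * (\<alpha> / b)) *\<^sub>R (snd s - fst s)
      + (b * ((b - \<alpha>) * (b - u) / (L * b)) - b * ((b - \<alpha>) / L)) *\<^sub>R G"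
    unfolding hb_step_def hb_point_def G_def by (simp add: algebra_simps)
  also have "b * (\<alpha> / b) = \<alpha>" using assms by simp
  also have "b * ((b - \<alpha>) * (b - u) / (L * b)) - b * ((b - \<alpha>) / L) = - ((b - \<alpha>) * u / L)"
    using assms by (simp add: field_simps)
  finally show ?thesis unfolding G_def by simp
qed

text \<open>With \<open>V k\<close> the scaled gap of the two components, consecutive curve points
  differ by \<open>hb_delta u k\<close> times \<open>V (Suc k)\<close>. The previous displacement
  divided by \<open>hb_delta u (k - 1)\<close> therefore recovers \<open>V k\<close>, and this
  quotient of deltas is \<open>hb_beta\<close>.\<close>

lemma heavy_ball_eq_hb_point:
  fixes g :: "'a::real_vector \<Rightarrow> 'a" and x0 :: 'a
  assumes A: "\<And>k. k \<le> K \<Longrightarrow> A k > 0" and u: "\<And>k. k \<le> K \<Longrightarrow> u k > 0"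
    and \<delta>: "\<And>k. k < K \<Longrightarrow> hb_delta u k \<noteq> 0" and L: "L \<noteq> 0" and k: "k \<le> K"
  defines "x \<equiv> heavy_ball (hb_eta L A u) (hb_beta u) g x0"
    and "s \<equiv> hb_state L g A x0 u"
  shows "x k = hb_point (A k) (s k) (u k)"
proof -
  define V where "V k = A k *\<^sub>R (snd (s k) - fst (s k))" for k
  have V_Suc: "V (Suc k) = V k - ((A (Suc k) - A k) * u k / L) *\<^sub>R g (hb_point (A k) (s k) (u k))"
    if "k < K" for k
    unfolding V_def s_def hb_state.simps
    using that A[of k] A[of "Suc k"] L by (subst hb_step_momentum) auto
  have pt: "hb_point (A k) (s k) t = snd (s k) - (1 / t) *\<^sub>R V k" for k t
    unfolding hb_point_def V_def by simp
  \<comment> \<open>The gradient cancels: replacing \<open>V k\<close> by \<open>V (Suc k)\<close>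
    at the fixed time \<open>u k\<close> releases the same multiple of it by which the second
    component moves. Only the change of the factor \<open>1 / t\<close> remains.\<close>
  have pt_Suc: "hb_point (A (Suc k)) (s (Suc k)) (u (Suc k)) =
      hb_point (A k) (s k) (u k) + hb_delta u k *\<^sub>R V (Suc k)" if "k < K" for k
  proof -
    define G where "G = g (hb_point (A k) (s k) (u k))"
    have "V k = V (Suc k) + ((A (Suc k) - A k) * u k / L) *\<^sub>R G"
      using V_Suc[OF that] unfolding G_def by simp
    moreover have "(1 / u k) * ((A (Suc k) - A k) * u k / L) = (A (Suc k) - A k) / L"
      using u[of k] that by simp
    ultimately have "hb_point (A k) (s k) (u k) =
        snd (s k) - (1 / u k) *\<^sub>R V (Suc k) - ((A (Suc k) - A k) / L) *\<^sub>R G"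
      unfolding pt[of k] by (simp only: scaleR_right_distrib scaleR_scaleR diff_diff_add)
    moreover have "snd (s (Suc k)) = snd (s k) - ((A (Suc k) - A k) / L) *\<^sub>R G"
      unfolding s_def G_def by (simp add: hb_step_def)
    ultimately show ?thesis
      unfolding pt[of "Suc k"] hb_delta_def by (simp add: scaleR_left_diff_distrib)
  qed
  show ?thesis
    using k
  \<comment> \<open>Strong induction, because the recursion refers to two earlier iterates.\<close>
  proof (induction k rule: less_induct)
    case (less k)
    show ?case
    proof (cases k)
      case 0
      then show ?thesis unfolding x_def s_def by (simp add: hb_point_def)
    next
      case (Suc m)
      then have m: "m < K" using less.prems by simp
      have xm: "x m = hb_point (A m) (s m) (u m)"
        using less.IH[of m] Suc m by simp
      have momentum: "hb_beta u m *\<^sub>R (x m - x (m - 1)) = hb_delta u m *\<^sub>R V m"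
      proof (cases m)
        \<comment> \<open>Both components start at \<open>x0\<close>, so \<open>V 0\<close>
          vanishes, in accordance with \<open>hb_beta u 0 = 0\<close>.\<close>
        case 0
        then show ?thesis unfolding hb_beta_def V_def s_def by simp
      next
        case (Suc n)
        then have n: "n < K" using m by simp
        have "x n = hb_point (A n) (s n) (u n)"
          using less.IH[of n] \<open>k = Suc m\<close> Suc n by simp
        then have "x m - x (m - 1) = hb_delta u n *\<^sub>R V m"
          using xm pt_Suc[OF n] Suc by simp
        then show ?thesis
          unfolding hb_beta_def using \<delta>[OF n] Suc by simp
      qed
      have "x k = x m - hb_eta L A u m *\<^sub>R g (x m) + hb_beta u m *\<^sub>R (x m - x (m - 1))"
        unfolding x_def Suc by simp
      also have "\<dots> = x m + hb_delta u m *\<^sub>R V (Suc m)"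
        unfolding momentum V_Suc[OF m] hb_eta_def xm[symmetric] by (simp add: algebra_simps)
      finally show ?thesis using pt_Suc[OF m] xm Suc by simp
    qed
  qed
qed

section \<open>Inequalities for a smooth convex function with a minimizer\<close>

locale smooth_convex_min =
  fixes f :: "'a::euclidean_space \<Rightarrow> real" and g :: "'a \<Rightarrow> 'a" and L :: real and xs :: 'a
  assumes L_pos: "L > 0"
    and convex: "convex_on UNIV f"
    and gderiv: "GDERIV f x :> g x"
    and lipschitz: "norm (g x - g y) \<le> L * norm (x - y)"
    and minimal: "f xs \<le> f x"
begin

lemma has_real_derivative_compose_path:
  assumes "(c has_vector_derivative c') (at t)"
  shows "((\<lambda>t. f (c t)) has_real_derivative inner (g (c t)) c') (at t)"
proof -
  have "((\<lambda>t. f (c t)) has_derivative (\<lambda>h. inner (h *\<^sub>R c') (g (c t)))) (at t)"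
    using has_derivative_compose[OF assms[unfolded has_vector_derivative_def]
        gderiv[unfolded gderiv_def]] .
  then show ?thesis
    by (rule has_derivative_imp_has_field_derivative) (simp add: inner_commute mult.commute)
qed

lemma has_real_derivative_line:
  "((\<lambda>t. f (x + t *\<^sub>R d)) has_real_derivative inner (g (x + t *\<^sub>R d)) d) (at t)"
  by (rule has_real_derivative_compose_path) (auto intro!: derivative_eq_intros)

lemma above_tangent: "f x + inner (g x) (y - x) \<le> f y"
proof -
  define d where "d = y - x"
  have "convex_on UNIV (\<lambda>t. f (x + t *\<^sub>R d))"
  proof (rule convex_onI)
    fix t a b :: real
    assume t: "0 < t" "t < 1"
    have "x + ((1 - t) *\<^sub>R a + t *\<^sub>R b) *\<^sub>R d =
        (1 - t) *\<^sub>R (x + a *\<^sub>R d) + t *\<^sub>R (x + b *\<^sub>R d)"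
      by (simp add: scaleR_add_left scaleR_diff_left scaleR_add_right scaleR_diff_right)
    then show "f (x + ((1 - t) *\<^sub>R a + t *\<^sub>R b) *\<^sub>R d) \<le>
        (1 - t) * f (x + a *\<^sub>R d) + t * f (x + b *\<^sub>R d)"
      using convex_onD[OF convex, of t "x + a *\<^sub>R d" "x + b *\<^sub>R d"] t by simp
  qed simp
  then have "inner (g x) d * (1 - 0) \<le> f (x + 1 *\<^sub>R d) - f (x + 0 *\<^sub>R d)"
    using has_real_derivative_line[of x d 0]
    by (intro convex_on_imp_above_tangent[where A = UNIV]) auto
  then show ?thesis by (simp add: d_def)
qed

lemma descent: "f (x + d) \<le> f x + inner (g x) d + L / 2 * (norm d)\<^sup>2"
proof -
  define p where "p t = f (x + t *\<^sub>R d) - t * inner (g x) d - L / 2 * t\<^sup>2 * (norm d)\<^sup>2" for t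
  have "p 1 \<le> p 0"
  proof (rule DERIV_nonpos_imp_nonincreasing[of 0 1 p])
    fix t :: real assume t: "0 \<le> t" "t \<le> 1"
    have "(p has_real_derivative
        (inner (g (x + t *\<^sub>R d)) d - inner (g x) d - L * t * (norm d)\<^sup>2)) (at t)"
      unfolding p_def[abs_def]
      by (rule derivative_eq_intros has_real_derivative_line refl | simp)+
    moreover have "inner (g (x + t *\<^sub>R d)) d - inner (g x) d \<le> L * t * (norm d)\<^sup>2"
    proof -
      have "inner (g (x + t *\<^sub>R d) - g x) d \<le> norm (g (x + t *\<^sub>R d) - g x) * norm d"
        by (rule norm_cauchy_schwarz)
      also have "\<dots> \<le> L * norm (t *\<^sub>R d) * norm d"
        using lipschitz[of "x + t *\<^sub>R d" x] by (intro mult_right_mono) auto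
      also have "\<dots> = L * t * (norm d)\<^sup>2"
        using t by (simp add: power2_eq_square)
      finally show ?thesis by (simp add: inner_diff_left)
    qed
    ultimately show "\<exists>D. (p has_real_derivative D) (at t) \<and> D \<le> 0"
      by (intro exI conjI) auto
  qed simp
  then show ?thesis unfolding p_def by simp
qed

lemma gradient_at_min: "g xs = 0"
proof -
  have "f xs \<le> f (xs + (- 1 / L) *\<^sub>R g xs)" by (rule minimal)
  also have "\<dots> \<le> f xs + inner (g xs) ((- 1 / L) *\<^sub>R g xs)
      + L / 2 * (norm ((- 1 / L) *\<^sub>R g xs))\<^sup>2"
    by (rule descent)
  also have "\<dots> = f xs - (norm (g xs))\<^sup>2 / (2 * L)"
    using L_pos by (simp add: power_mult_distrib power_divide dot_square_norm power2_eq_square field_simps)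
  finally have "(norm (g xs))\<^sup>2 / (2 * L) \<le> 0" by simp
  then have "(norm (g xs))\<^sup>2 \<le> 0" using L_pos by (simp add: divide_le_0_iff)
  then show ?thesis by simp
qed

lemma gap_le: "f x - f xs \<le> L / 2 * (norm (x - xs))\<^sup>2"
  using descent[of xs "x - xs"] gradient_at_min by simp

text \<open>The value at \<open>xs + w\<close> is bounded below by the tangent at \<open>x\<close>
  and above by descent from \<open>xs\<close>, where the gradient vanishes. The choice of
  \<open>w\<close> maximizes \<open>inner (g x) w - L / 2 * (norm w)\<^sup>2\<close>, and this
  maximum is the extra gradient term, which later absorbs errors.\<close>

lemma gap_plus_gradient_le:
  "f x - f xs + (norm (g x))\<^sup>2 / (2 * L) \<le> inner (g x) (x - xs)"
proof -
  define w where "w = (1 / L) *\<^sub>R g x"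
  have "norm w = norm (g x) / L" unfolding w_def using L_pos by simp
  then have 1: "L / 2 * (norm w)\<^sup>2 = (norm (g x))\<^sup>2 / (2 * L)"
    using L_pos by (simp add: power_divide power2_eq_square)
  have 2: "inner (g x) w = 2 * ((norm (g x))\<^sup>2 / (2 * L))"
    unfolding w_def using L_pos by (simp add: dot_square_norm)
  have "f x + inner (g x) (xs + w - x) \<le> f (xs + w)" by (rule above_tangent)
  moreover have "f (xs + w) \<le> f xs + L / 2 * (norm w)\<^sup>2"
    using descent[of xs w] gradient_at_min by simp
  moreover have "inner (g x) (xs + w - x) = inner (g x) w - inner (g x) (x - xs)"
    by (simp add: inner_diff_right inner_add_right)
  ultimately show ?thesis using 1 2 by linarith
qed

lemma continuous_f: "continuous_on UNIV f"
  using gderiv unfolding gderiv_def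
  by (meson continuous_at_imp_continuous_on has_derivative_continuous)

lemma continuous_g: "continuous_on UNIV g"
proof -
  have "L-lipschitz_on UNIV g"
    using lipschitz L_pos by (intro lipschitz_onI) (auto simp: dist_norm)
  then show ?thesis by (rule lipschitz_on_continuous_on)
qed

lemma measurable_f [measurable]: "f \<in> borel_measurable borel"
  using continuous_f by (rule borel_measurable_continuous_onI)

lemma measurable_g [measurable]: "g \<in> borel_measurable borel"
  using continuous_g by (rule borel_measurable_continuous_onI)

section \<open>Pointwise change of the Lyapunov function in one step\<close>

definition potential :: "real \<Rightarrow> 'a \<times> 'a \<Rightarrow> real" where
  "potential \<alpha> s = \<alpha> * (f (fst s) - f xs) + L / 2 * (norm (snd s - xs))\<^sup>2"

lemma potential_nonneg: "0 \<le> \<alpha> \<Longrightarrow> 0 \<le> potential \<alpha> s"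
  unfolding potential_def using minimal[of "fst s"] L_pos by simp

text \<open>In the application \<open>G\<close> is the gradient at the sampled time,
  \<open>H\<close> the one at the right end of the interval and \<open>r\<close> the time left.
  Trading \<open>G\<close> for \<open>H\<close> pays off because \<open>H\<close> does not depend on
  the sampled time and \<open>a - 2 * r\<close> has mean zero for \<open>r\<close> uniform on
  [0, a].\<close>

lemma momentum_cross_term_le:
  fixes G H :: 'a
  assumes a: "0 \<le> r" "r \<le> a" and c: "c \<le> 1 / 2"
  shows "- (norm G)\<^sup>2 + a * (norm G)\<^sup>2 - 2 * r * inner H G + c * (norm G)\<^sup>2
    \<le> (a - 2 * r) * (norm H)\<^sup>2 + (2 * a\<^sup>2 + a) * (norm (G - H))\<^sup>2"
proof -
  define nG nH d q where "nG = (norm G)\<^sup>2" and "nH = (norm H)\<^sup>2"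
    and "d = (norm (G - H))\<^sup>2" and "q = inner G (G - H)"
  have HG: "inner H G = nG - q"
    unfolding q_def nG_def by (simp add: inner_diff_right dot_square_norm inner_commute)
  have nH: "nH = d + nG - 2 * q"
    unfolding q_def nG_def nH_def d_def power2_norm_eq_inner
    by (simp add: inner_diff_right inner_diff_left inner_commute[of H G])
  have d0: "0 \<le> d" "0 \<le> nG" unfolding d_def nG_def by simp_all
  \<comment> \<open>AM-GM for \<open>2 (a - r) <G, G - H>\<close>; half of \<open>|G|^2\<close> is left over to absorb \<open>c |G|^2\<close>.\<close>
  have "0 \<le> (norm (G - (2 * (a - r)) *\<^sub>R (G - H)))\<^sup>2" by simp
  also have "\<dots> = nG - 2 * (2 * (a - r)) * q + (2 * (a - r))\<^sup>2 * d"
    unfolding q_def nG_def d_def power2_norm_eq_inner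
    by (simp only: inner_diff_right[of _ G] inner_diff_right[of _ _ "_ *\<^sub>R _"]
        inner_diff_left[of G "_ *\<^sub>R _"] inner_scaleR_left inner_scaleR_right
        inner_commute[of "G - H" G] power2_eq_square)
      (simp add: algebra_simps)
  finally have 1: "2 * (a - r) * q \<le> nG / 2 + 2 * (a - r)\<^sup>2 * d"
    by (simp add: algebra_simps power2_eq_square)
  have "(a - r)\<^sup>2 \<le> a\<^sup>2" using a by (intro power_mono) auto
  then have 2: "(a - r)\<^sup>2 * d \<le> a\<^sup>2 * d" using d0(1) by (rule mult_right_mono)
  have 3: "r * d \<le> a * d" using a d0 by (intro mult_right_mono) auto
  have 4: "c * nG \<le> 1 / 2 * nG" using c d0 by (intro mult_right_mono) auto
  have "- nG + a * nG - 2 * r * (nG - q) + c * nG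
      \<le> (a - 2 * r) * (d + nG - 2 * q) + (2 * a\<^sup>2 + a) * d"
    using 1 2 3 4 by (simp add: algebra_simps)
  then show ?thesis unfolding HG nH_def[symmetric] nG_def[symmetric] d_def[symmetric] nH .
qed

text \<open>Three estimates are added: descent from \<open>X b\<close> to the new first component,
  the expansion of the squared distance of the second component, and
  \<open>gap_plus_gradient_le\<close> at \<open>X u\<close>. The leftover gradient terms form the
  left-hand side of \<open>momentum_cross_term_le\<close> with \<open>c = a * r\<^sup>2 / b\<close>;
  \<open>small\<close> keeps this \<open>c\<close> below 1/2.\<close>

lemma hb_step_potential_le:
  fixes s :: "'a \<times> 'a"
  assumes \<alpha>: "0 < \<alpha>" and u: "\<alpha> \<le> u" "u \<le> b" and small: "(b - \<alpha>) ^ 3 \<le> b / 2"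
  defines "a \<equiv> b - \<alpha>" and "X \<equiv> hb_point \<alpha> s" and "w \<equiv> norm (snd s - fst s)"
  shows "potential b (hb_step L g \<alpha> b s u) \<le>
    b * (f (X b) - f xs) + L / 2 * (norm (snd s - xs))\<^sup>2
    - a * (f (X u) - f xs + inner (g (X u)) ((\<alpha> / u) *\<^sub>R (snd s - fst s)))
    + a / (2 * L) * ((a - 2 * (b - u)) * (norm (g (X b)))\<^sup>2
        + (2 * a\<^sup>2 + a) * (L * w / b)\<^sup>2 * (b - u)\<^sup>2)"
proof -
  define z r G H \<gamma> where "z = snd s" and "r = b - u" and "G = g (X u)" and "H = g (X b)"
    and "\<gamma> = a * r / (L * b)"
  have pos: "0 < u" "0 < b" "0 \<le> r" "r \<le> a" "0 \<le> a"
    using \<alpha> u unfolding r_def a_def by auto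
  have step: "hb_step L g \<alpha> b s u = (X b - \<gamma> *\<^sub>R G, z - (a / L) *\<^sub>R G)"
    unfolding hb_step_def \<gamma>_def a_def r_def G_def X_def z_def by simp
  have fy: "f (X b - \<gamma> *\<^sub>R G) \<le> f (X b) - \<gamma> * inner H G + L / 2 * (\<gamma>\<^sup>2 * (norm G)\<^sup>2)"
    using descent[of "X b" "- (\<gamma> *\<^sub>R G)"] by (simp add: H_def power_mult_distrib)
  have "b * (L / 2 * (\<gamma>\<^sup>2 * (norm G)\<^sup>2)) = a / (2 * L) * (a * r\<^sup>2 / b * (norm G)\<^sup>2)"
    unfolding \<gamma>_def using L_pos pos by (simp add: field_simps power2_eq_square)
  moreover have "b * (\<gamma> * inner H G) = a / (2 * L) * (2 * r * inner H G)"
    unfolding \<gamma>_def using L_pos pos by (simp add: field_simps)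
  moreover have "b * (f (X b - \<gamma> *\<^sub>R G) - f xs)
      \<le> b * (f (X b) - \<gamma> * inner H G + L / 2 * (\<gamma>\<^sup>2 * (norm G)\<^sup>2) - f xs)"
    using fy pos by (intro mult_left_mono) auto
  ultimately have 1: "b * (f (X b - \<gamma> *\<^sub>R G) - f xs) \<le> b * (f (X b) - f xs)
      + a / (2 * L) * (- 2 * r * inner H G + a * r\<^sup>2 / b * (norm G)\<^sup>2)"
    by (simp add: algebra_simps)
  have "(norm (z - (a / L) *\<^sub>R G - xs))\<^sup>2 = (norm (z - xs - (a / L) *\<^sub>R G))\<^sup>2"
    by (simp add: algebra_simps)
  also have "\<dots> = (norm (z - xs))\<^sup>2 - 2 * (a / L) * inner G (z - xs) + (a / L)\<^sup>2 * (norm G)\<^sup>2"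
    unfolding power2_norm_eq_inner inner_diff_left[of "z - xs"] inner_diff_right[of _ "z - xs"]
    by (simp add: inner_commute[of "z - xs" G] power2_eq_square)
  finally have "L / 2 * (norm (z - (a / L) *\<^sub>R G - xs))\<^sup>2 =
      L / 2 * ((norm (z - xs))\<^sup>2 - 2 * (a / L) * inner G (z - xs) + (a / L)\<^sup>2 * (norm G)\<^sup>2)"
    by simp
  also have "\<dots> = L / 2 * (norm (z - xs))\<^sup>2 - a * inner G (z - xs) + a / (2 * L) * (a * (norm G)\<^sup>2)"
    using L_pos by (simp add: field_simps power2_eq_square)
  finally have 2: "L / 2 * (norm (z - (a / L) *\<^sub>R G - xs))\<^sup>2 =
      L / 2 * (norm (z - xs))\<^sup>2 - a * inner G (z - xs) + a / (2 * L) * (a * (norm G)\<^sup>2)" .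
  \<comment> \<open>The inner product with the second summand is kept, since it is \<open>u\<close>
    times the derivative of \<open>f\<close> along the curve and will be integrated exactly.\<close>
  have "z - xs = (X u - xs) + (\<alpha> / u) *\<^sub>R (snd s - fst s)"
    unfolding X_def hb_point_def z_def by simp
  then have "inner G (z - xs) = inner G (X u - xs) + inner G ((\<alpha> / u) *\<^sub>R (snd s - fst s))"
    by (simp only: inner_add_right)
  then have "f (X u) - f xs + inner G ((\<alpha> / u) *\<^sub>R (snd s - fst s)) + (norm G)\<^sup>2 / (2 * L)
      \<le> inner G (z - xs)"
    using gap_plus_gradient_le[of "X u"] unfolding G_def by simp
  then have "a * (f (X u) - f xs + inner G ((\<alpha> / u) *\<^sub>R (snd s - fst s)) + (norm G)\<^sup>2 / (2 * L))
      \<le> a * inner G (z - xs)"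
    using pos by (intro mult_left_mono) auto
  then have 3: "- (a * inner G (z - xs)) \<le>
      - a * (f (X u) - f xs + inner G ((\<alpha> / u) *\<^sub>R (snd s - fst s))) + a / (2 * L) * (- (norm G)\<^sup>2)"
    by (simp add: algebra_simps)
  \<comment> \<open>Bounding \<open>\<alpha> / u\<close> by 1 makes the distance linear in
    \<open>r\<close>, so that its square has an explicit integral.\<close>
  have "X u - X b = (\<alpha> / b - \<alpha> / u) *\<^sub>R (snd s - fst s)"
    unfolding X_def hb_point_def by (simp add: algebra_simps)
  then have "norm (X u - X b) = \<bar>\<alpha> / b - \<alpha> / u\<bar> * w"
    unfolding w_def by simp
  also have "\<bar>\<alpha> / b - \<alpha> / u\<bar> = \<alpha> / u * (r / b)"
    using pos \<alpha> u unfolding r_def by (simp add: field_simps abs_if)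
  also have "\<alpha> / u * (r / b) \<le> 1 * (r / b)"
    using pos \<alpha> u by (intro mult_right_mono) auto
  finally have "norm (X u - X b) \<le> r / b * w" by (simp add: w_def mult_right_mono)
  then have "L * norm (X u - X b) \<le> L * (r / b * w)" using L_pos by (intro mult_left_mono) auto
  then have "norm (G - H) \<le> L * w / b * r"
    using lipschitz[of "X u" "X b"] unfolding G_def H_def by (simp add: mult.commute mult.left_commute)
  then have "(norm (G - H))\<^sup>2 \<le> (L * w / b * r)\<^sup>2" by (intro power_mono) auto
  then have "(2 * a\<^sup>2 + a) * (norm (G - H))\<^sup>2 \<le> (2 * a\<^sup>2 + a) * (L * w / b * r)\<^sup>2"
    using pos by (intro mult_left_mono) auto
  then have "(2 * a\<^sup>2 + a) * (norm (G - H))\<^sup>2 \<le> (2 * a\<^sup>2 + a) * (L * w / b)\<^sup>2 * r\<^sup>2"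
    by (simp only: power_mult_distrib mult.assoc)
  moreover have "a * r\<^sup>2 / b \<le> 1 / 2"
  proof -
    have "a * r\<^sup>2 \<le> a * a\<^sup>2" using pos by (intro mult_left_mono power_mono) auto
    also have "\<dots> = (b - \<alpha>) ^ 3" unfolding a_def by (simp add: power2_eq_square power3_eq_cube)
    finally show ?thesis using small pos by (simp add: field_simps)
  qed
  ultimately have "- (norm G)\<^sup>2 + a * (norm G)\<^sup>2 - 2 * r * inner H G + a * r\<^sup>2 / b * (norm G)\<^sup>2
      \<le> (a - 2 * r) * (norm H)\<^sup>2 + (2 * a\<^sup>2 + a) * (L * w / b)\<^sup>2 * r\<^sup>2"
    using momentum_cross_term_le[OF pos(3,4), of "a * r\<^sup>2 / b" G H] by linarith
  then have "a / (2 * L) * (- (norm G)\<^sup>2 + a * (norm G)\<^sup>2 - 2 * r * inner H G + a * r\<^sup>2 / b * (norm G)\<^sup>2)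
      \<le> a / (2 * L) * ((a - 2 * r) * (norm H)\<^sup>2 + (2 * a\<^sup>2 + a) * (L * w / b)\<^sup>2 * r\<^sup>2)"
    using pos L_pos by (intro mult_left_mono) auto
  moreover have "a / (2 * L) * (- (norm G)\<^sup>2 + a * (norm G)\<^sup>2 - 2 * r * inner H G + a * r\<^sup>2 / b * (norm G)\<^sup>2)
      = a / (2 * L) * (- 2 * r * inner H G + a * r\<^sup>2 / b * (norm G)\<^sup>2)
        + a / (2 * L) * (a * (norm G)\<^sup>2) + a / (2 * L) * (- (norm G)\<^sup>2)"
    by (simp only: distrib_left[symmetric]) (simp add: algebra_simps)
  moreover have "potential b (hb_step L g \<alpha> b s u) =
      b * (f (X b - \<gamma> *\<^sub>R G) - f xs) + L / 2 * (norm (z - (a / L) *\<^sub>R G - xs))\<^sup>2"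
    unfolding step potential_def by simp
  ultimately show ?thesis
    using 1 2 3 unfolding G_def[symmetric] H_def[symmetric] r_def[symmetric] z_def[symmetric]
    by linarith
qed

section \<open>Averaging one step over the uniform time\<close>

lemma has_vector_derivative_hb_point:
  assumes "t \<noteq> 0"
  shows "(hb_point \<alpha> s has_vector_derivative (\<alpha> / t\<^sup>2) *\<^sub>R (snd s - fst s)) (at t)"
proof -
  have "((\<lambda>t. \<alpha> / t) has_real_derivative - (\<alpha> / t\<^sup>2)) (at t)"
    using assms by (auto intro!: derivative_eq_intros simp: power2_eq_square)
  from has_vector_derivative_scaleR[OF this has_vector_derivative_const[of "snd s - fst s"]]
  have "((\<lambda>t. (\<alpha> / t) *\<^sub>R (snd s - fst s)) has_vector_derivative
      - ((\<alpha> / t\<^sup>2) *\<^sub>R (snd s - fst s))) (at t)"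
    by simp
  from has_vector_derivative_diff[OF has_vector_derivative_const[of "snd s"] this]
  show ?thesis unfolding hb_point_def[abs_def] by simp
qed

text \<open>The pointwise bound is an exact derivative in the sampled time, so the fundamental
  theorem evaluates its mean. The quadratic remainder has mean
  \<open>(a ^ 4 + 2 * a ^ 5) / (3 * b\<^sup>2)\<close> times \<open>L / 2 * w\<^sup>2\<close>, which
  explains the form of the condition on \<open>\<tau>\<close>.\<close>

lemma nn_integral_hb_step_potential_le:
  fixes s :: "'a \<times> 'a"
  assumes \<alpha>: "0 < \<alpha>" "\<alpha> < b" and small: "(b - \<alpha>) ^ 3 \<le> b / 2"
    and \<tau>: "(b - \<alpha>) ^ 4 + 2 * (b - \<alpha>) ^ 5 \<le> 3 * \<tau> * b\<^sup>2"
  shows "(\<integral>\<^sup>+u. ennreal (potential b (hb_step L g \<alpha> b s u)) \<partial>uniform_measure lborel {\<alpha><..<b})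
    \<le> ennreal (potential \<alpha> s + L / 2 * \<tau> * (norm (snd s - fst s))\<^sup>2)"
proof -
  define a X v w where "a = b - \<alpha>" and "X = hb_point \<alpha> s" and "v = snd s - fst s" and "w = norm v"
  define B c n \<kappa> where "B = b * (f (X b) - f xs) + L / 2 * (norm (snd s - xs))\<^sup>2"
    and "c = a / (2 * L)" and "n = (norm (g (X b)))\<^sup>2"
    and "\<kappa> = (2 * a\<^sup>2 + a) * (L * w / b)\<^sup>2"
  define h where "h u = B - a * (f (X u) - f xs + inner (g (X u)) ((\<alpha> / u) *\<^sub>R v))
      + c * ((a - 2 * (b - u)) * n + \<kappa> * (b - u)\<^sup>2)" for u
  \<comment> \<open>The antiderivative of \<open>h\<close>. Its term in \<open>n\<close> vanishes at both end points.\<close>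
  define J where "J u = u * B - a * (u * (f (X u) - f xs))
      + c * ((b - u) * (b - u - a) * n - \<kappa> * (b - u) ^ 3 / 3)" for u
  have a: "0 < a" "0 < b" using \<alpha> unfolding a_def by auto
  have step_le: "potential b (hb_step L g \<alpha> b s u) \<le> h u" if "\<alpha> \<le> u" "u \<le> b" for u
    using hb_step_potential_le[OF \<alpha>(1) that small, of s]
    unfolding h_def B_def c_def n_def \<kappa>_def a_def X_def v_def w_def .
  have h0: "0 \<le> h u" if "\<alpha> \<le> u" "u \<le> b" for u
    using step_le[OF that] potential_nonneg[of b] a by (meson less_imp_le order_trans)
  have X_meas [measurable]: "X \<in> borel_measurable borel"
    unfolding X_def hb_point_def[abs_def] by measurable
  have h_meas [measurable]: "h \<in> borel_measurable borel"
    unfolding h_def[abs_def] by measurable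
  have J_deriv: "(J has_real_derivative h u) (at u)" if "\<alpha> \<le> u" "u \<le> b" for u
  proof -
    have u: "u \<noteq> 0" using that \<alpha> by auto
    have fX: "((\<lambda>u. f (X u)) has_real_derivative inner (g (X u)) ((\<alpha> / u\<^sup>2) *\<^sub>R v)) (at u)"
      unfolding X_def v_def
      by (rule has_real_derivative_compose_path has_vector_derivative_hb_point u)+
    have *: "u * inner (g (X u)) ((\<alpha> / u\<^sup>2) *\<^sub>R v) = inner (g (X u)) ((\<alpha> / u) *\<^sub>R v)"
      using u by (simp add: power2_eq_square)
    have tf: "((\<lambda>u. u * (f (X u) - f xs)) has_real_derivative
        (f (X u) - f xs + inner (g (X u)) ((\<alpha> / u) *\<^sub>R v))) (at u)"
      unfolding *[symmetric] by (rule derivative_eq_intros fX refl | simp)+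
    have quad: "((\<lambda>u. (b - u) * (b - u - a) * n) has_real_derivative (a - 2 * (b - u)) * n) (at u)"
      by (rule derivative_eq_intros refl | simp add: algebra_simps)+
    have cube: "((\<lambda>u. \<kappa> * (b - u) ^ 3 / 3) has_real_derivative - (\<kappa> * (b - u)\<^sup>2)) (at u)"
      by (rule derivative_eq_intros refl | simp)+
    have "(J has_real_derivative
        (B - a * (f (X u) - f xs + inner (g (X u)) ((\<alpha> / u) *\<^sub>R v))
        + c * ((a - 2 * (b - u)) * n - (- (\<kappa> * (b - u)\<^sup>2))))) (at u)"
      unfolding J_def[abs_def]
      by (intro DERIV_add DERIV_diff DERIV_cmult tf quad cube)
        (auto intro!: derivative_eq_intros)
    then show ?thesis unfolding h_def by simp
  qed
  \<comment> \<open>At \<open>u = b\<close> the antiderivative cancels the function gap contained in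
    \<open>B\<close>; at \<open>u = \<alpha>\<close> it supplies the gap at \<open>fst s\<close>,
    which rebuilds \<open>potential \<alpha> s\<close>.\<close>
  have "X \<alpha> = fst s" unfolding X_def hb_point_def using \<alpha> by simp
  then have "J b - J \<alpha> = (b - \<alpha>) * B - a * (b * (f (X b) - f xs)) + a * (\<alpha> * (f (fst s) - f xs))
      + c * (\<kappa> * a ^ 3 / 3)"
    unfolding J_def a_def by (simp add: algebra_simps)
  also have "\<dots> = a * (potential \<alpha> s + \<kappa> * a ^ 3 / (6 * L))"
    unfolding potential_def B_def a_def[symmetric] c_def by (simp add: algebra_simps)
  finally have J: "J b - J \<alpha> = a * (potential \<alpha> s + \<kappa> * a ^ 3 / (6 * L))" .
  have "\<kappa> * a ^ 3 / (6 * L) = (a ^ 4 + 2 * a ^ 5) / (3 * b\<^sup>2) * (L / 2 * w\<^sup>2)"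
    unfolding \<kappa>_def using L_pos a by (simp add: field_simps power_numeral_reduce)
  also have "\<dots> \<le> \<tau> * (L / 2 * w\<^sup>2)"
    using \<tau> a L_pos unfolding a_def[symmetric]
    by (intro mult_right_mono) (auto simp: divide_le_eq mult.commute mult.left_commute)
  finally have \<kappa>: "\<kappa> * a ^ 3 / (6 * L) \<le> L / 2 * \<tau> * w\<^sup>2" by (simp add: mult.commute mult.left_commute)
  have "(\<integral>\<^sup>+u. ennreal (potential b (hb_step L g \<alpha> b s u)) \<partial>uniform_measure lborel {\<alpha><..<b})
      \<le> (\<integral>\<^sup>+u. ennreal (h u) \<partial>uniform_measure lborel {\<alpha><..<b})"
    by (intro nn_integral_mono_AE AE_uniform_measureI AE_I2) (auto intro!: ennreal_leI step_le)
  also have "\<dots> = (\<integral>\<^sup>+u. ennreal (h u) * indicator {\<alpha><..<b} u \<partial>lborel) / emeasure lborel {\<alpha><..<b}"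
    by (rule nn_integral_uniform_measure) auto
  \<comment> \<open>Passing to the closed interval fits the fundamental theorem and can only enlarge
    the integral of a nonnegative function.\<close>
  also have "(\<integral>\<^sup>+u. ennreal (h u) * indicator {\<alpha><..<b} u \<partial>lborel)
      \<le> (\<integral>\<^sup>+u. ennreal (h u) * indicator {\<alpha>..b} u \<partial>lborel)"
    by (intro nn_integral_mono mult_left_mono) (auto split: split_indicator)
  also have "\<dots> = ennreal (J b - J \<alpha>)"
    using \<alpha> h0 J_deriv h_meas by (intro nn_integral_FTC_Icc) auto
  also have "emeasure lborel {\<alpha><..<b} = ennreal a" using \<alpha> unfolding a_def by simp
  also have "ennreal (J b - J \<alpha>) / ennreal a = ennreal ((J b - J \<alpha>) / a)"
  proof (rule divide_ennreal[OF _ a(1)])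
    have "0 \<le> \<kappa>" unfolding \<kappa>_def using a by simp
    then show "0 \<le> J b - J \<alpha>"
      unfolding J using a L_pos \<alpha> potential_nonneg[of \<alpha> s] by simp
  qed
  also have "(J b - J \<alpha>) / a = potential \<alpha> s + \<kappa> * a ^ 3 / (6 * L)" unfolding J using a by simp
  also have "ennreal \<dots> \<le> ennreal (potential \<alpha> s + L / 2 * \<tau> * w\<^sup>2)"
    using \<kappa> by (intro ennreal_leI) simp
  finally show ?thesis
    unfolding w_def v_def by (simp add: divide_right_mono_ennreal)
qed

section \<open>Distance of the first component to the minimizer\<close>

text \<open>For \<open>u\<close> between \<open>\<alpha>\<close> and \<open>b\<close> the three
  weights are nonnegative with sum \<open>b\<close>, so the new first component is a convex
  combination of points whose distances are under control.\<close>

lemma hb_step_weighted_average: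
  assumes "b \<noteq> 0"
  shows "b *\<^sub>R fst (hb_step L g \<alpha> b s u) =
    \<alpha> *\<^sub>R fst s + (u - \<alpha>) *\<^sub>R snd s + (b - u) *\<^sub>R snd (hb_step L g \<alpha> b s u)"
proof -
  define G where "G = g (hb_point \<alpha> s u)"
  have "b *\<^sub>R fst (hb_step L g \<alpha> b s u) =
      b *\<^sub>R snd s - (b * (\<alpha> / b)) *\<^sub>R (snd s - fst s) - (b * ((b - \<alpha>) * (b - u) / (L * b))) *\<^sub>R G"
    unfolding hb_step_def hb_point_def[of _ _ b] G_def by (simp only: fst_conv scaleR_right_diff_distrib scaleR_scaleR)
  also have "b * (\<alpha> / b) = \<alpha>" using assms by simp
  also have "b * ((b - \<alpha>) * (b - u) / (L * b)) = (b - u) * ((b - \<alpha>) / L)" using assms by simp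
  also have "b *\<^sub>R snd s - \<alpha> *\<^sub>R (snd s - fst s) - ((b - u) * ((b - \<alpha>) / L)) *\<^sub>R G =
      \<alpha> *\<^sub>R fst s + (u - \<alpha>) *\<^sub>R snd s + (b - u) *\<^sub>R (snd s - ((b - \<alpha>) / L) *\<^sub>R G)"
    by (simp only: scaleR_right_diff_distrib[of "b - u"] scaleR_scaleR) (simp add: algebra_simps)
  finally show ?thesis by (simp add: hb_step_def G_def)
qed

text \<open>Convexity of the squared norm is applied to the weighted average, and each second
  component is at squared distance at most \<open>2 / L\<close> times its potential. Enlarging both
  of their weights to \<open>b - \<alpha>\<close> doubles this constant, hence the
  \<open>4 / L\<close> in \<open>expectation_hb_state_le\<close>.\<close>

lemma hb_step_norm_le:
  fixes s :: "'a \<times> 'a"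
  assumes \<alpha>: "0 < \<alpha>" and u: "\<alpha> \<le> u" "u \<le> b"
  defines "s' \<equiv> hb_step L g \<alpha> b s u"
  shows "b * (norm (fst s' - xs))\<^sup>2 \<le> \<alpha> * (norm (fst s - xs))\<^sup>2
    + (b - \<alpha>) * (2 / L) * (potential \<alpha> s + potential b s')"
proof -
  have b: "0 < b" using assms by simp
  have z_le: "(norm (snd t - xs))\<^sup>2 \<le> 2 / L * potential \<beta> t" if "0 \<le> \<beta>" for \<beta> and t :: "'a \<times> 'a"
  proof -
    have "0 \<le> \<beta> * (f (fst t) - f xs)" using that minimal[of "fst t"] by simp
    then have "2 / L * (L / 2 * (norm (snd t - xs))\<^sup>2) \<le> 2 / L * potential \<beta> t"
      unfolding potential_def using L_pos by (intro mult_left_mono) auto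
    then show ?thesis using L_pos by simp
  qed
  define p q N0 N1 N2 where "p = u - \<alpha>" and "q = b - u"
    and "N0 = norm (fst s - xs)" and "N1 = norm (snd s - xs)" and "N2 = norm (snd s' - xs)"
  have pq: "0 \<le> p" "0 \<le> q" and b_eq: "b = \<alpha> + p + q" using u unfolding p_def q_def by auto
  have "b *\<^sub>R (fst s' - xs) = b *\<^sub>R fst s' - \<alpha> *\<^sub>R xs - p *\<^sub>R xs - q *\<^sub>R xs"
    unfolding b_eq by (simp add: algebra_simps)
  also have "\<dots> = \<alpha> *\<^sub>R (fst s - xs) + p *\<^sub>R (snd s - xs) + q *\<^sub>R (snd s' - xs)"
    using hb_step_weighted_average[of b \<alpha> s u] b unfolding s'_def[symmetric] p_def q_def
    by (simp add: scaleR_right_diff_distrib)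
  finally have "b * norm (fst s' - xs) =
      norm (\<alpha> *\<^sub>R (fst s - xs) + p *\<^sub>R (snd s - xs) + q *\<^sub>R (snd s' - xs))"
    using b by (metis abs_of_pos norm_scaleR)
  also have "\<dots> \<le> \<alpha> * N0 + p * N1 + q * N2"
    unfolding N0_def N1_def N2_def using \<alpha> pq
    by (intro norm_triangle_le add_mono order_refl) auto
  finally have "(b * norm (fst s' - xs))\<^sup>2 \<le> (\<alpha> * N0 + p * N1 + q * N2)\<^sup>2"
    using b by (intro power_mono) auto
  also have "\<dots> \<le> b * (\<alpha> * N0\<^sup>2 + p * N1\<^sup>2 + q * N2\<^sup>2)"
  proof -
    \<comment> \<open>Variance identity for three numbers: the weighted pairwise squared differences
      equal the gap in Jensen's inequality.\<close>
    have "0 \<le> \<alpha> * p * (N0 - N1)\<^sup>2 + \<alpha> * q * (N0 - N2)\<^sup>2 + p * q * (N1 - N2)\<^sup>2"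
      using \<alpha> pq by simp
    also have "\<dots> = b * (\<alpha> * N0\<^sup>2 + p * N1\<^sup>2 + q * N2\<^sup>2) - (\<alpha> * N0 + p * N1 + q * N2)\<^sup>2"
      unfolding b_eq by (simp add: power2_eq_square algebra_simps)
    finally show ?thesis by simp
  qed
  finally have "b * (b * (norm (fst s' - xs))\<^sup>2) \<le> b * (\<alpha> * N0\<^sup>2 + p * N1\<^sup>2 + q * N2\<^sup>2)"
    by (simp add: power2_eq_square mult.assoc mult.left_commute)
  then have "b * (norm (fst s' - xs))\<^sup>2 \<le> \<alpha> * N0\<^sup>2 + p * N1\<^sup>2 + q * N2\<^sup>2"
    using b by simp
  also have "p * N1\<^sup>2 \<le> (b - \<alpha>) * (2 / L * potential \<alpha> s)"
    unfolding N1_def p_def using u \<alpha> z_le[of \<alpha> s] by (intro mult_mono) auto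
  also have "q * N2\<^sup>2 \<le> (b - \<alpha>) * (2 / L * potential b s')"
    unfolding N2_def q_def using u b z_le[of b s'] \<alpha> by (intro mult_mono) auto
  finally show ?thesis unfolding N0_def by (simp only: distrib_left mult.assoc add.assoc)
qed

section \<open>Measurability and independence\<close>

lemma measurable_hb_step [measurable]:
  "(\<lambda>p. hb_step L g \<alpha> b (fst p) (snd p))
    \<in> (borel \<Otimes>\<^sub>M borel) \<Otimes>\<^sub>M borel \<rightarrow>\<^sub>M borel \<Otimes>\<^sub>M borel"
  unfolding hb_step_def hb_point_def by measurable

lemma measurable_potential [measurable]:
  "potential \<alpha> \<in> borel_measurable (borel \<Otimes>\<^sub>M borel)"
  unfolding potential_def[abs_def] by measurable

text \<open>The state after \<open>k\<close> steps reads only the first \<open>k\<close> times, so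
  it lives on a finite product space and can be separated from the next sampled time.\<close>

lemma measurable_hb_state:
  "k \<le> n \<Longrightarrow> (\<lambda>v. hb_state L g A x0 v k) \<in> PiM {..<n} (\<lambda>_. borel) \<rightarrow>\<^sub>M borel \<Otimes>\<^sub>M borel"
proof (induction k)
  case 0
  then show ?case by simp
next
  case (Suc k)
  then have "(\<lambda>v. (hb_state L g A x0 v k, v k)) \<in> PiM {..<n} (\<lambda>_. borel) \<rightarrow>\<^sub>M (borel \<Otimes>\<^sub>M borel) \<Otimes>\<^sub>M borel"
    by (intro measurable_Pair measurable_component_singleton) auto
  from measurable_compose[OF this measurable_hb_step[of "A k" "A (Suc k)"]]
  show ?case by simp
qed

end

text \<open>Takes the place of conditioning on \<open>X\<close>: independence makes the joint law a
  product, and Tonelli integrates \<open>Y\<close> out first. Working with nonnegative integrals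
  yields integrability as a conclusion.\<close>

lemma (in prob_space) indep_var_integral_le:
  fixes F :: "'b \<times> 'b \<Rightarrow> real" and H :: "'b \<Rightarrow> real"
  assumes indep: "indep_var S X T Y"
    and F [measurable]: "F \<in> borel_measurable (S \<Otimes>\<^sub>M T)" and F_nonneg: "\<And>p. 0 \<le> F p"
    and H [measurable]: "H \<in> borel_measurable S" and H_nonneg: "\<And>x. 0 \<le> H x"
    and int: "integrable M (\<lambda>\<omega>. H (X \<omega>))"
    and le: "\<And>x. (\<integral>\<^sup>+\<omega>. ennreal (F (x, Y \<omega>)) \<partial>M) \<le> ennreal (H x)"
  shows "integrable M (\<lambda>\<omega>. F (X \<omega>, Y \<omega>)) \<and>
    (\<integral>\<omega>. F (X \<omega>, Y \<omega>) \<partial>M) \<le> (\<integral>\<omega>. H (X \<omega>) \<partial>M)"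
proof -
  have X [measurable]: "X \<in> M \<rightarrow>\<^sub>M S" and Y [measurable]: "Y \<in> M \<rightarrow>\<^sub>M T"
    and joint: "distr M S X \<Otimes>\<^sub>M distr M T Y = distr M (S \<Otimes>\<^sub>M T) (\<lambda>\<omega>. (X \<omega>, Y \<omega>))"
    using indep unfolding indep_var_distribution_eq by auto
  interpret Y: prob_space "distr M T Y" by (rule prob_space_distr) simp
  have "(\<integral>\<^sup>+\<omega>. ennreal (F (X \<omega>, Y \<omega>)) \<partial>M)
      = (\<integral>\<^sup>+p. ennreal (F p) \<partial>distr M (S \<Otimes>\<^sub>M T) (\<lambda>\<omega>. (X \<omega>, Y \<omega>)))"
    by (subst nn_integral_distr) auto
  also have "\<dots> = (\<integral>\<^sup>+x. \<integral>\<^sup>+y. ennreal (F (x, y)) \<partial>distr M T Y \<partial>distr M S X)"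
    unfolding joint[symmetric] by (subst Y.nn_integral_fst[symmetric]) auto
  also have "\<dots> \<le> (\<integral>\<^sup>+x. ennreal (H x) \<partial>distr M S X)"
  proof (intro nn_integral_mono)
    fix x assume "x \<in> space (distr M S X)"
    then have [measurable]: "x \<in> space S" by simp
    show "(\<integral>\<^sup>+y. ennreal (F (x, y)) \<partial>distr M T Y) \<le> ennreal (H x)"
      using le[of x] by (subst nn_integral_distr) auto
  qed
  also have "\<dots> = (\<integral>\<^sup>+\<omega>. ennreal (H (X \<omega>)) \<partial>M)"
    by (subst nn_integral_distr) auto
  also have "\<dots> = ennreal (\<integral>\<omega>. H (X \<omega>) \<partial>M)"
    using int H_nonneg by (intro nn_integral_eq_integral) auto
  finally have *: "(\<integral>\<^sup>+\<omega>. ennreal (F (X \<omega>, Y \<omega>)) \<partial>M) \<le> ennreal (\<integral>\<omega>. H (X \<omega>) \<partial>M)" .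
  have int_F: "integrable M (\<lambda>\<omega>. F (X \<omega>, Y \<omega>))"
  proof (rule integrableI_bounded)
    show "(\<integral>\<^sup>+\<omega>. ennreal (norm (F (X \<omega>, Y \<omega>))) \<partial>M) < \<infinity>"
      using * F_nonneg by (simp add: le_less_trans)
  qed measurable
  moreover have "ennreal (\<integral>\<omega>. F (X \<omega>, Y \<omega>) \<partial>M) \<le> ennreal (\<integral>\<omega>. H (X \<omega>) \<partial>M)"
    using * F_nonneg by (subst nn_integral_eq_integral[symmetric, OF int_F]) auto
  ultimately show ?thesis
    using H_nonneg by (simp add: ennreal_le_iff integral_nonneg)
qed

section \<open>Growth of the expected potential over all steps\<close>

context smooth_convex_min
begin

text \<open>The gap of the components is split at \<open>xs\<close>; one of the two squares is part
  of the potential, the other is tracked separately.\<close>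

lemma norm_diff_le_potential:
  fixes s :: "'a \<times> 'a"
  assumes "0 \<le> \<alpha>" and "0 \<le> \<tau>"
  shows "potential \<alpha> s + L / 2 * \<tau> * (norm (snd s - fst s))\<^sup>2
    \<le> (1 + 2 * \<tau>) * potential \<alpha> s + \<tau> * L * (norm (fst s - xs))\<^sup>2"
proof -
  define x y where "x = norm (snd s - xs)" and "y = norm (fst s - xs)"
  have "norm (snd s - fst s) \<le> x + y"
    unfolding x_def y_def using norm_triangle_ineq4[of "snd s - xs" "fst s - xs"] by simp
  then have "(norm (snd s - fst s))\<^sup>2 \<le> (x + y)\<^sup>2" by (intro power_mono) auto
  also have "\<dots> \<le> 2 * x\<^sup>2 + 2 * y\<^sup>2"
    using zero_le_power2[of "x - y"] by (simp add: power2_eq_square algebra_simps)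
  finally have "L / 2 * \<tau> * (norm (snd s - fst s))\<^sup>2 \<le> L / 2 * \<tau> * (2 * x\<^sup>2 + 2 * y\<^sup>2)"
    using assms L_pos by (intro mult_left_mono) auto
  also have "\<dots> = 2 * \<tau> * (L / 2 * x\<^sup>2) + \<tau> * L * y\<^sup>2" by (simp add: algebra_simps)
  also have "2 * \<tau> * (L / 2 * x\<^sup>2) \<le> 2 * \<tau> * potential \<alpha> s"
    using assms minimal[of "fst s"] unfolding potential_def x_def by (intro mult_left_mono) auto
  finally show ?thesis unfolding y_def by (simp add: algebra_simps)
qed

text \<open>
  The drift of the potential involves \<open>|y - x*|^2\<close>, which the potential does not control. Since
  \<open>y\<close> is a weighted average of the earlier \<open>z\<close>, its second moment inherits the bound for the
  potential, so the two moments are estimated in one induction.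
\<close>

lemma expectation_hb_state_le:
  fixes M :: "'w measure" and u :: "nat \<Rightarrow> 'w \<Rightarrow> real" and x0 :: 'a
  assumes prob: "prob_space M" and indep: "prob_space.indep_vars M (\<lambda>_. borel) u {..<K}"
    and unif: "\<And>k. k < K \<Longrightarrow> distr M borel (u k) = uniform_measure lborel {A k<..<A (Suc k)}"
    and A: "\<And>k. 0 < A k" "\<And>k. k < K \<Longrightarrow> A k < A (Suc k)" and \<tau>0: "0 \<le> \<tau>"
    and small: "\<And>k. k < K \<Longrightarrow> (A (Suc k) - A k) ^ 3 \<le> A (Suc k) / 2"
    and \<tau>: "\<And>k. k < K \<Longrightarrow>
      (A (Suc k) - A k) ^ 4 + 2 * (A (Suc k) - A k) ^ 5 \<le> 3 * \<tau> * (A (Suc k))\<^sup>2"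
    and k: "k \<le> K"
  defines "S \<equiv> \<lambda>k \<omega>. hb_state L g A x0 (\<lambda>i. u i \<omega>) k"
    and "C \<equiv> \<lambda>k. (1 + 6 * \<tau>) ^ k * potential (A 0) (x0, x0)"
  shows "integrable M (\<lambda>\<omega>. potential (A k) (S k \<omega>)) \<and>
    integrable M (\<lambda>\<omega>. (norm (fst (S k \<omega>) - xs))\<^sup>2) \<and>
    (\<integral>\<omega>. potential (A k) (S k \<omega>) \<partial>M) \<le> C k \<and>
    (\<integral>\<omega>. (norm (fst (S k \<omega>) - xs))\<^sup>2 \<partial>M) \<le> 4 / L * C k"
  using k
proof (induction k)
  case 0
  interpret prob_space M by (rule prob)
  have "L / 4 * (norm (x0 - xs))\<^sup>2 \<le> L / 2 * (norm (x0 - xs))\<^sup>2"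
    using L_pos by (intro mult_right_mono) auto
  also have "\<dots> \<le> potential (A 0) (x0, x0)"
    unfolding potential_def using A(1)[of 0] minimal[of x0] by simp
  finally have "4 / L * (L / 4 * (norm (x0 - xs))\<^sup>2) \<le> 4 / L * potential (A 0) (x0, x0)"
    using L_pos by (intro mult_left_mono) auto
  then show ?case unfolding S_def C_def using L_pos by (simp add: prob_space)
next
  case (Suc k)
  then have k: "k < K" by simp
  interpret prob_space M by (rule prob)
  define \<alpha> b where "\<alpha> = A k" and "b = A (Suc k)"
  have \<alpha>: "0 < \<alpha>" "\<alpha> < b" "0 < b" using A k unfolding \<alpha>_def b_def by auto
  note IH = Suc.IH[OF less_imp_le[OF k], folded \<alpha>_def]
  have C_mono: "C k \<le> C (Suc k)"
  proof -
    have "1 * C k \<le> (1 + 6 * \<tau>) * C k"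
      using \<tau>0 A(1)[of 0] potential_nonneg[of "A 0"] unfolding C_def
      by (intro mult_right_mono mult_nonneg_nonneg) auto
    then show ?thesis unfolding C_def by simp
  qed
  have u_meas [measurable]: "u i \<in> borel_measurable M" if "i < K" for i
    using indep that unfolding indep_vars_def by auto
  have S_Suc: "S (Suc k) \<omega> = hb_step L g \<alpha> b (S k \<omega>) (u k \<omega>)" for \<omega>
    unfolding S_def \<alpha>_def b_def by simp
  \<comment> \<open>Past times and the current time go into disjoint products, as required by
    \<open>indep_var_restrict\<close>; the restriction leaves the state unchanged.\<close>
  define X Y where "X \<omega> = restrict (\<lambda>i. u i \<omega>) {..<k}" and "Y \<omega> = restrict (\<lambda>i. u i \<omega>) {k}" for \<omega>
  have XY: "indep_var (PiM {..<k} (\<lambda>_. borel)) X (PiM {k} (\<lambda>_. borel)) Y"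
    unfolding X_def[abs_def] Y_def[abs_def] using k by (intro indep_var_restrict[OF indep]) auto
  have S_eq: "hb_state L g A x0 (X \<omega>) k = S k \<omega>" for \<omega>
    unfolding S_def X_def by (rule hb_state_cong) simp
  have Y_eq: "Y \<omega> k = u k \<omega>" for \<omega> unfolding Y_def by simp
  note [measurable] = measurable_hb_state[of k k A x0]
  define F where "F p = potential b (hb_step L g \<alpha> b (hb_state L g A x0 (fst p) k) (snd p k))" for p
  define H where "H v = (1 + 2 * \<tau>) * potential \<alpha> (hb_state L g A x0 v k)
      + \<tau> * L * (norm (fst (hb_state L g A x0 v k) - xs))\<^sup>2" for v
  have step: "integrable M (\<lambda>\<omega>. F (X \<omega>, Y \<omega>)) \<and>
      (\<integral>\<omega>. F (X \<omega>, Y \<omega>) \<partial>M) \<le> (\<integral>\<omega>. H (X \<omega>) \<partial>M)"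
  proof (rule indep_var_integral_le[OF XY])
    have [measurable]: "(\<lambda>p. (hb_state L g A x0 (fst p) k, snd p k)) \<in>
        PiM {..<k} (\<lambda>_. borel) \<Otimes>\<^sub>M PiM {k} (\<lambda>_. borel) \<rightarrow>\<^sub>M (borel \<Otimes>\<^sub>M borel) \<Otimes>\<^sub>M borel"
      by (intro measurable_Pair measurable_compose[OF measurable_fst measurable_hb_state]
          measurable_compose[OF measurable_snd measurable_component_singleton]) auto
    from measurable_compose[OF measurable_compose[OF this measurable_hb_step] measurable_potential]
    show "F \<in> borel_measurable (PiM {..<k} (\<lambda>_. borel) \<Otimes>\<^sub>M PiM {k} (\<lambda>_. borel))"
      unfolding F_def[abs_def] by simp
    show "H \<in> borel_measurable (PiM {..<k} (\<lambda>_. borel))"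
      unfolding H_def[abs_def] by measurable
    show "0 \<le> F p" for p unfolding F_def using \<alpha> by (simp add: potential_nonneg)
    show "0 \<le> H v" for v unfolding H_def using \<alpha> \<tau>0 L_pos by (simp add: potential_nonneg)
    show "integrable M (\<lambda>\<omega>. H (X \<omega>))"
      unfolding H_def S_eq using IH by simp
    show "(\<integral>\<^sup>+\<omega>. ennreal (F (v, Y \<omega>)) \<partial>M) \<le> ennreal (H v)" for v
    proof -
      let ?s = "hb_state L g A x0 v k"
      have [measurable]: "(\<lambda>t. hb_step L g \<alpha> b ?s t) \<in> borel \<rightarrow>\<^sub>M borel \<Otimes>\<^sub>M borel"
        using measurable_compose[OF measurable_Pair1'[of ?s "borel \<Otimes>\<^sub>M borel" borel] measurable_hb_step]
        by (simp add: space_pair_measure)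
      have "(\<integral>\<^sup>+\<omega>. ennreal (F (v, Y \<omega>)) \<partial>M)
          = (\<integral>\<^sup>+t. ennreal (potential b (hb_step L g \<alpha> b ?s t)) \<partial>distr M borel (u k))"
        unfolding F_def using k by (subst nn_integral_distr) (auto simp: Y_eq)
      also have "\<dots> \<le> ennreal (potential \<alpha> ?s + L / 2 * \<tau> * (norm (snd ?s - fst ?s))\<^sup>2)"
        unfolding unif[OF k] \<alpha>_def b_def
        by (rule nn_integral_hb_step_potential_le[OF A(1) A(2)[OF k] small[OF k] \<tau>[OF k]])
      also have "\<dots> \<le> ennreal (H v)"
        unfolding H_def using \<alpha> \<tau>0 by (intro ennreal_leI norm_diff_le_potential) auto
      finally show ?thesis .
    qed
  qed
  have int': "integrable M (\<lambda>\<omega>. potential b (S (Suc k) \<omega>))"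
    using step unfolding F_def fst_conv snd_conv S_eq Y_eq S_Suc by blast
  have "(\<integral>\<omega>. potential b (S (Suc k) \<omega>) \<partial>M) \<le> (\<integral>\<omega>. H (X \<omega>) \<partial>M)"
    using step unfolding F_def fst_conv snd_conv S_eq Y_eq S_Suc by blast
  also have "\<dots> = (1 + 2 * \<tau>) * (\<integral>\<omega>. potential \<alpha> (S k \<omega>) \<partial>M)
      + \<tau> * L * (\<integral>\<omega>. (norm (fst (S k \<omega>) - xs))\<^sup>2 \<partial>M)"
    unfolding H_def S_eq using IH by simp
  \<comment> \<open>The growth factor \<open>1 + 6 * \<tau>\<close> arises as
    \<open>1 + 2 * \<tau>\<close> from the potential plus \<open>4 * \<tau>\<close> from
    \<open>\<tau> * L\<close> times \<open>4 / L\<close>.\<close>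
  also have "\<dots> \<le> (1 + 2 * \<tau>) * C k + \<tau> * L * (4 / L * C k)"
    using IH \<tau>0 L_pos by (intro add_mono mult_left_mono) auto
  also have "\<dots> = C (Suc k)" unfolding C_def using L_pos by (simp add: algebra_simps)
  finally have E': "(\<integral>\<omega>. potential b (S (Suc k) \<omega>) \<partial>M) \<le> C (Suc k)" .
  have "AE t in distr M borel (u k). t \<in> {\<alpha><..<b}"
    unfolding unif[OF k] \<alpha>_def b_def by (rule AE_uniform_measureI) auto
  then have "AE \<omega> in M. u k \<omega> \<in> {\<alpha><..<b}"
    using k by (subst (asm) AE_distr_iff) auto
  then have norm_le: "AE \<omega> in M. (norm (fst (S (Suc k) \<omega>) - xs))\<^sup>2 \<le>
      \<alpha> / b * (norm (fst (S k \<omega>) - xs))\<^sup>2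
      + (b - \<alpha>) * (2 / L) / b * (potential \<alpha> (S k \<omega>) + potential b (S (Suc k) \<omega>))" (is "AE \<omega> in M. _ \<le> ?R \<omega>")
  proof eventually_elim
    case (elim \<omega>)
    then have "b * (norm (fst (S (Suc k) \<omega>) - xs))\<^sup>2 \<le> \<alpha> * (norm (fst (S k \<omega>) - xs))\<^sup>2
        + (b - \<alpha>) * (2 / L) * (potential \<alpha> (S k \<omega>) + potential b (S (Suc k) \<omega>))"
      using hb_step_norm_le[OF \<alpha>(1), of "u k \<omega>" b "S k \<omega>"] unfolding S_Suc by simp
    from divide_right_mono[OF this, of b] \<alpha>(3) show ?case
      by (simp only: add_divide_distrib times_divide_eq_left) simp
  qed
  have int_R: "integrable M ?R" using IH int' by simp
  have "S (Suc k) \<in> M \<rightarrow>\<^sub>M borel \<Otimes>\<^sub>M borel"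
  proof -
    have X': "(\<lambda>\<omega>. restrict (\<lambda>i. u i \<omega>) {..<Suc k}) \<in> M \<rightarrow>\<^sub>M PiM {..<Suc k} (\<lambda>_. borel)"
      using k by (intro measurable_restrict) auto
    have "hb_state L g A x0 (restrict (\<lambda>i. u i \<omega>) {..<Suc k}) (Suc k) = S (Suc k) \<omega>" for \<omega>
      unfolding S_def by (rule hb_state_cong) simp
    with measurable_compose[OF X' measurable_hb_state[of "Suc k" "Suc k" A x0]]
    show ?thesis by simp
  qed
  then have [measurable]: "(\<lambda>\<omega>. S (Suc k) \<omega>) \<in> M \<rightarrow>\<^sub>M borel \<Otimes>\<^sub>M borel" by simp
  have int_norm: "integrable M (\<lambda>\<omega>. (norm (fst (S (Suc k) \<omega>) - xs))\<^sup>2)"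
    by (rule Bochner_Integration.integrable_bound[OF int_R]) (use norm_le in auto)
  have "(\<integral>\<omega>. (norm (fst (S (Suc k) \<omega>) - xs))\<^sup>2 \<partial>M) \<le> (\<integral>\<omega>. ?R \<omega> \<partial>M)"
    by (rule integral_mono_AE[OF int_norm int_R norm_le])
  also have "\<dots> = \<alpha> / b * (\<integral>\<omega>. (norm (fst (S k \<omega>) - xs))\<^sup>2 \<partial>M) + (b - \<alpha>) * (2 / L) / b *
      ((\<integral>\<omega>. potential \<alpha> (S k \<omega>) \<partial>M) + (\<integral>\<omega>. potential b (S (Suc k) \<omega>) \<partial>M))"
    using IH int' by simp
  \<comment> \<open>The bound reproduces itself: \<open>4 / L * C (Suc k)\<close> is averaged with
    the weights \<open>\<alpha> / b\<close> and \<open>(b - \<alpha>) / b\<close>, whose sum is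
    1.\<close>
  also have "\<dots> \<le> \<alpha> / b * (4 / L * C (Suc k)) + (b - \<alpha>) * (2 / L) / b * (C (Suc k) + C (Suc k))"
  proof (intro add_mono mult_left_mono)
    have "4 / L * C k \<le> 4 / L * C (Suc k)" using C_mono L_pos by (intro mult_left_mono) auto
    then show "(\<integral>\<omega>. (norm (fst (S k \<omega>) - xs))\<^sup>2 \<partial>M) \<le> 4 / L * C (Suc k)" using IH by linarith
  qed (use IH E' C_mono \<alpha> L_pos in auto)
  also have "\<dots> = 4 / L * C (Suc k)" using \<alpha> L_pos by (simp add: field_simps)
  finally show ?case using int' E' int_norm unfolding b_def by blast
qed

end

text \<open>Agreement with \<open>hb_state\<close> holds only almost surely and \<open>M\<close>
  need not be complete, so measurability is read off the recursion itself.\<close>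

lemma measurable_heavy_ball:
  fixes g :: "'a::euclidean_space \<Rightarrow> 'a" and u :: "nat \<Rightarrow> 'w \<Rightarrow> real"
  assumes [measurable]: "g \<in> borel_measurable borel"
    and u: "\<And>i. i \<le> K \<Longrightarrow> u i \<in> borel_measurable M" and k: "k \<le> K"
  shows "(\<lambda>\<omega>. heavy_ball (hb_eta L A (\<lambda>i. u i \<omega>)) (hb_beta (\<lambda>i. u i \<omega>)) g x0 k) \<in> borel_measurable M"
  using k
proof (induction k rule: less_induct)
  case (less k)
  show ?case
  proof (cases k)
    case (Suc m)
    define x where "x k \<omega> = heavy_ball (hb_eta L A (\<lambda>i. u i \<omega>)) (hb_beta (\<lambda>i. u i \<omega>)) g x0 k"
      for k \<omega>
    have [measurable]: "x m \<in> borel_measurable M" "x (m - 1) \<in> borel_measurable M"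
      unfolding x_def[abs_def] using less.prems Suc by (auto intro!: less.IH)
    have \<delta> [measurable]: "(\<lambda>\<omega>. hb_delta (\<lambda>i. u i \<omega>) i) \<in> borel_measurable M" if "i < K" for i
    proof -
      have [measurable]: "u i \<in> borel_measurable M" "u (Suc i) \<in> borel_measurable M"
        using that by (auto intro!: u)
      show ?thesis unfolding hb_delta_def by measurable
    qed
    have [measurable]: "u m \<in> borel_measurable M"
        "(\<lambda>\<omega>. hb_delta (\<lambda>i. u i \<omega>) m) \<in> borel_measurable M"
        "(\<lambda>\<omega>. hb_delta (\<lambda>i. u i \<omega>) (m - 1)) \<in> borel_measurable M"
      using less.prems Suc by (auto intro!: u \<delta>)
    have "(\<lambda>\<omega>. x m \<omega> - hb_eta L A (\<lambda>i. u i \<omega>) m *\<^sub>R g (x m \<omega>)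
        + hb_beta (\<lambda>i. u i \<omega>) m *\<^sub>R (x m \<omega> - x (m - 1) \<omega>)) \<in> borel_measurable M"
      unfolding hb_eta_def hb_beta_def by measurable
    then show ?thesis unfolding x_def Suc by simp
  qed simp
qed

section \<open>Estimates for the grid\<close>

text \<open>With \<open>q\<close> the root of the right grid point and \<open>h\<close> the
  increment of the roots, a grid step is at most \<open>2 * h * q\<close>. The exponent 1/3 in
  \<open>grid\<close> keeps \<open>h\<^sup>2 * q\<close> bounded while \<open>h ^ 3\<close> is of
  order 1/K, so the fourth and fifth powers of the step, relative to the squared grid point, are at
  most of order 1/K.\<close>

lemma grid_step_bounds:
  assumes K: "K \<ge> 1" and k: "k < K"
  shows "grid K k < grid K (Suc k)"
    and "(grid K (Suc k) - grid K k) ^ 3 \<le> grid K (Suc k) / 2"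
    and "(grid K (Suc k) - grid K k) ^ 4 + 2 * (grid K (Suc k) - grid K k) ^ 5
      \<le> 3 * (1 / (42 * real K)) * (grid K (Suc k))\<^sup>2"
proof -
  define c h p q a where "c = real K powr (1/3)" and "h = 1 / (6 * c)" and "p = 1 + real k * h"
    and "q = p + h" and "a = grid K (Suc k) - grid K k"
  have c1: "1 \<le> c" unfolding c_def using K by (intro ge_one_powr_ge_zero) auto
  have c3: "c ^ 3 = real K" unfolding c_def using K by (simp add: powr_power)
  have h: "0 < h" unfolding h_def using c1 by simp
  have p: "1 \<le> p" unfolding p_def using h by simp
  have grid_k: "grid K k = p\<^sup>2" unfolding grid_def p_def h_def c_def by simp
  have grid_Suc: "grid K (Suc k) = q\<^sup>2"
    unfolding grid_def q_def p_def h_def c_def by (simp add: add_divide_distrib)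
  have a_eq: "a = h * (p + q)" unfolding a_def grid_k grid_Suc q_def by (simp add: power2_eq_square algebra_simps)
  have a0: "0 < a" unfolding a_eq using h p unfolding q_def by simp
  then show "grid K k < grid K (Suc k)" unfolding a_def by simp
  have a_le: "a \<le> 2 * h * q" unfolding a_eq using h unfolding q_def by simp
  have "real k + 1 \<le> c ^ 3" using k c3 by simp
  then have "(real k + 1) * h \<le> c ^ 3 * h" using h by (intro mult_right_mono) auto
  also have "\<dots> = c\<^sup>2 / 6" unfolding h_def using c1 by (simp add: power2_eq_square power3_eq_cube)
  finally have q_le: "q \<le> 1 + c\<^sup>2 / 6" unfolding q_def p_def by (simp add: algebra_simps)
  also have "\<dots> \<le> 7 / 6 * c\<^sup>2" using one_le_power[OF c1, of 2] by simp
  finally have q_le: "q \<le> 7 / 6 * c\<^sup>2" .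
  have q0: "0 < q" unfolding q_def using p h by simp
  have hc: "h * c = 1 / 6" unfolding h_def using c1 by simp
  have h_le: "h \<le> 1 / 6" unfolding h_def using c1 by (simp add: field_simps)
  have "h\<^sup>2 * q \<le> h\<^sup>2 * (7 / 6 * c\<^sup>2)" using q_le by (intro mult_left_mono) auto
  also have "\<dots> = 7 / 6 * (h * c)\<^sup>2" by (simp add: power_mult_distrib)
  also have "\<dots> = 7 / 216" unfolding hc by (simp add: power2_eq_square)
  finally have h2q: "h\<^sup>2 * q \<le> 7 / 216" .
  have "a ^ 3 \<le> (2 * h * q) ^ 3" using a_le a0 by (intro power_mono) auto
  also have "\<dots> = 8 * h * (h\<^sup>2 * q) * q\<^sup>2" by (simp add: power_mult_distrib power2_eq_square power3_eq_cube)
  also have "\<dots> \<le> 8 * (1 / 6) * (7 / 216) * q\<^sup>2"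
    using h_le h2q h q0 by (intro mult_right_mono mult_mono) auto
  also have "\<dots> \<le> 1 / 2 * q\<^sup>2" by (intro mult_right_mono) auto
  finally show "(grid K (Suc k) - grid K k) ^ 3 \<le> grid K (Suc k) / 2"
    unfolding a_def grid_Suc[symmetric] by simp
  have "h ^ 3 * c ^ 3 = 1 / 216" unfolding power_mult_distrib[symmetric] hc by (simp add: power3_eq_cube)
  then have h3: "h ^ 3 = 1 / (216 * real K)" unfolding c3 using K by (simp add: field_simps)
  have "a ^ 4 + 2 * a ^ 5 \<le> (2 * h * q) ^ 4 + 2 * (2 * h * q) ^ 5"
    using a_le a0 by (intro add_mono mult_left_mono power_mono) auto
  also have "\<dots> = h ^ 3 * (16 * h + 64 * (h\<^sup>2 * q)) * (q\<^sup>2)\<^sup>2"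
    by (simp add: power_mult_distrib power_numeral_reduce algebra_simps)
  also have "\<dots> \<le> h ^ 3 * (16 * (1 / 6) + 64 * (7 / 216)) * (q\<^sup>2)\<^sup>2"
    using h_le h2q h by (intro mult_right_mono mult_left_mono add_mono) auto
  \<comment> \<open>The bracket equals 128/27, and 128/27 divided by 216 is below 3/42.\<close>
  also have "\<dots> \<le> 3 * (1 / (42 * real K)) * (q\<^sup>2)\<^sup>2"
    unfolding h3 using K by (intro mult_right_mono) (auto simp: field_simps)
  finally show "(grid K (Suc k) - grid K k) ^ 4 + 2 * (grid K (Suc k) - grid K k) ^ 5
      \<le> 3 * (1 / (42 * real K)) * (grid K (Suc k))\<^sup>2"
    unfolding a_def grid_Suc[symmetric] .
qed

lemma grid_pos: "0 < grid K k"
proof -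
  have "0 < 1 + real k / (6 * real K powr (1/3))" by (simp add: add_pos_nonneg)
  then show ?thesis unfolding grid_def by simp
qed

text \<open>At the last index the root is \<open>1 + c\<^sup>2 / 6\<close>; dropping the 1 and
  squaring produces both the rate and the constant 36.\<close>

lemma grid_last_ge:
  assumes "K \<ge> 1"
  shows "real K powr (4/3) / 36 \<le> grid K K"
proof -
  define c where "c = real K powr (1/3)"
  have c: "0 < c" unfolding c_def using assms by simp
  have c3: "c ^ 3 = real K" and c4: "c ^ 4 = real K powr (4/3)"
    unfolding c_def using assms by (simp_all add: powr_power)
  have "real K / (6 * c) = c\<^sup>2 / 6"
    unfolding c3[symmetric] using c by (simp add: power2_eq_square power3_eq_cube)
  then have "grid K K = (1 + c\<^sup>2 / 6)\<^sup>2" unfolding grid_def c_def[symmetric] by (simp only:)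
  moreover have "(c\<^sup>2 / 6)\<^sup>2 \<le> (1 + c\<^sup>2 / 6)\<^sup>2" by (intro power_mono) auto
  moreover have "(c\<^sup>2 / 6)\<^sup>2 = c ^ 4 / 36" by (simp add: power_divide)
  ultimately show ?thesis unfolding c4 by simp
qed

section \<open>Almost sure positivity of the deltas and the final rate\<close>

theorem theorem6:
  fixes f :: "'a::euclidean_space \<Rightarrow> real" and L :: real and xstar x0 :: 'a
    and K :: nat and M :: "'w measure" and u :: "nat \<Rightarrow> 'w \<Rightarrow> real"
  assumes "L > 0"
    and "convex_on UNIV f"
    and "L_smooth L f"
    and "\<And>y. f xstar \<le> f y"
    and "K \<ge> 1"
    and "prob_space M"
    and "prob_space.indep_vars M (\<lambda>_. borel) u {..<K}"
    and "\<And>k. k < K \<Longrightarrow>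
           distr M borel (u k) = uniform_measure lborel {grid K k<..<grid K (Suc k)}"
    and "\<And>\<omega>. u K \<omega> = grid K K"
  defines "x \<equiv> \<lambda>\<omega>. heavy_ball (hb_eta L (grid K) (\<lambda>k. u k \<omega>)) (hb_beta (\<lambda>k. u k \<omega>)) (grad f) x0"
  shows "(AE \<omega> in M. \<forall>k<K. hb_delta (\<lambda>k. u k \<omega>) k > 0) \<and>
         integrable M (\<lambda>\<omega>. f (x \<omega> K) - f xstar) \<and>
         (\<integral>\<omega>. (f (x \<omega> K) - f xstar) \<partial>M)
           \<le> 36 * exp (1/7) * L * (norm (x0 - xstar))\<^sup>2 / real K powr (4/3)"
proof -
  interpret prob_space M by fact
  interpret smooth_convex_min f "grad f" L xstar
    using assms(1-4) by unfold_locales (auto simp: L_smooth_def intro: differentiable_imp_gderiv_grad)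
  note indep = assms(7) and unif = assms(8) and last = assms(9) and K = \<open>K \<ge> 1\<close>
  define S where "S \<omega> = hb_state L (grad f) (grid K) x0 (\<lambda>i. u i \<omega>) K" for \<omega>
  define D C where "D = (norm (x0 - xstar))\<^sup>2" and "C = potential (grid K 0) (x0, x0)"
  have u_meas: "u i \<in> borel_measurable M" if "i \<le> K" for i
  proof (cases "i = K")
    case True
    then show ?thesis using last by (simp add: fun_eq_iff[of "u K"] cong: measurable_cong)
  next
    case False
    then show ?thesis using indep that unfolding indep_vars_def by auto
  qed
  have "AE \<omega> in M. u k \<omega> \<in> {grid K k<..<grid K (Suc k)}" if "k < K" for k
  proof -
    have "AE t in distr M borel (u k). t \<in> {grid K k<..<grid K (Suc k)}"
      unfolding unif[OF that] by (rule AE_uniform_measureI) auto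
    then show ?thesis using that u_meas[of k] by (subst (asm) AE_distr_iff) auto
  qed
  then have u_in: "AE \<omega> in M. \<forall>k\<in>{..<K}. u k \<omega> \<in> {grid K k<..<grid K (Suc k)}"
    by (intro AE_finite_allI) auto
  have u_pos: "0 < u k \<omega>"
    if "\<forall>k\<in>{..<K}. u k \<omega> \<in> {grid K k<..<grid K (Suc k)}" "k \<le> K" for \<omega> k
  proof (cases "k = K")
    case True
    then show ?thesis using last[of \<omega>] grid_pos[of K K] by simp
  next
    case False
    then have "grid K k < u k \<omega>" using that by auto
    then show ?thesis using grid_pos[of K k] by linarith
  qed
  have \<delta>_pos: "hb_delta (\<lambda>k. u k \<omega>) k > 0"
    if in_grid: "\<forall>k\<in>{..<K}. u k \<omega> \<in> {grid K k<..<grid K (Suc k)}" and k: "k < K" for \<omega> k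
  proof -
    have "u k \<omega> < grid K (Suc k)" using in_grid k by auto
    \<comment> \<open>At \<open>Suc k = K\<close> the next time is the grid point itself, so
      strictness has to come from \<open>u k\<close>.\<close>
    also have "\<dots> \<le> u (Suc k) \<omega>"
    proof (cases "Suc k = K")
      case True
      then show ?thesis using last[of \<omega>] by simp
    next
      case False
      then have "Suc k \<in> {..<K}" using k by simp
      from bspec[OF in_grid this] show ?thesis by simp
    qed
    finally show ?thesis
      unfolding hb_delta_def using u_pos[OF in_grid, of k] k by (simp add: frac_less2)
  qed
  have \<delta>: "AE \<omega> in M. \<forall>k<K. hb_delta (\<lambda>k. u k \<omega>) k > 0"
    using u_in by eventually_elim (use \<delta>_pos in blast)
  \<comment> \<open>Since \<open>u K\<close> is \<open>grid K K\<close>, the curve is evaluated at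
    its starting time, where it equals the first component.\<close>
  have x_eq: "AE \<omega> in M. f (x \<omega> K) - f xstar = f (fst (S \<omega>)) - f xstar"
    using u_in
  proof eventually_elim
    case (elim \<omega>)
    have "x \<omega> K = hb_point (grid K K) (S \<omega>) (u K \<omega>)"
      unfolding x_def S_def
      by (rule heavy_ball_eq_hb_point[where K = K])
        (use elim grid_pos u_pos \<delta>_pos less_imp_neq[OF \<delta>_pos] L_pos in force)+
    then show ?case using grid_pos[of K K] by (simp add: last hb_point_def)
  qed
  \<comment> \<open>The choice \<open>\<tau> = 1 / (42 * real K)\<close> turns
    \<open>1 + 6 * \<tau>\<close> into 1 + 1/(7K), whose K-th power is at most
    \<open>exp (1/7)\<close>.\<close>
  have E: "integrable M (\<lambda>\<omega>. potential (grid K K) (S \<omega>)) \<and>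
      (\<integral>\<omega>. potential (grid K K) (S \<omega>) \<partial>M) \<le> (1 + 6 * (1 / (42 * real K))) ^ K * C"
    using expectation_hb_state_le[OF \<open>prob_space M\<close> indep unif grid_pos grid_step_bounds(1)[OF K] _
        grid_step_bounds(2)[OF K] grid_step_bounds(3)[OF K] order_refl, of x0]
    unfolding S_def C_def by simp
  have gap_le_potential: "f (fst (S \<omega>)) - f xstar \<le> potential (grid K K) (S \<omega>) / grid K K" for \<omega>
    unfolding potential_def using grid_pos[of K K] L_pos by (simp add: field_simps)
  have x_meas: "(\<lambda>\<omega>. f (x \<omega> K) - f xstar) \<in> borel_measurable M"
    unfolding x_def
    by (intro borel_measurable_diff measurable_compose[OF measurable_heavy_ball[OF measurable_g u_meas] measurable_f]) auto
  have bound: "AE \<omega> in M. f (x \<omega> K) - f xstar \<le> potential (grid K K) (S \<omega>) / grid K K"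
    using x_eq by eventually_elim (use gap_le_potential in simp)
  have int: "integrable M (\<lambda>\<omega>. f (x \<omega> K) - f xstar)"
  proof (rule Bochner_Integration.integrable_bound)
    show "integrable M (\<lambda>\<omega>. potential (grid K K) (S \<omega>) / grid K K)" using E by simp
    show "AE \<omega> in M. norm (f (x \<omega> K) - f xstar) \<le> norm (potential (grid K K) (S \<omega>) / grid K K)"
      using bound
    proof eventually_elim
      case (elim \<omega>)
      then show ?case
        using minimal[of "x \<omega> K"] abs_ge_self[of "potential (grid K K) (S \<omega>) / grid K K"]
        unfolding real_norm_def by linarith
    qed
  qed (rule x_meas)
  \<comment> \<open>Since \<open>grid K 0\<close> is 1, the function gap contributes at most
    \<open>L * D / 2\<close> by \<open>gap_le\<close>, and the distance term equals
    \<open>L * D / 2\<close>.\<close>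
  have "C \<le> L * D"
    unfolding C_def D_def potential_def using gap_le[of x0] by (simp add: grid_def)
  have "(\<integral>\<omega>. (f (x \<omega> K) - f xstar) \<partial>M) \<le> (\<integral>\<omega>. potential (grid K K) (S \<omega>) / grid K K \<partial>M)"
    using E by (intro integral_mono_AE int bound) auto
  also have "\<dots> = (\<integral>\<omega>. potential (grid K K) (S \<omega>) \<partial>M) / grid K K" by simp
  also have "\<dots> \<le> (exp (1/7) * (L * D)) / (real K powr (4/3) / 36)"
  proof (rule frac_le)
    have "(1 + 6 * (1 / (42 * real K))) ^ K \<le> exp (1 / (7 * real K)) ^ K"
      using exp_ge_add_one_self[of "1 / (7 * real K)"] by (intro power_mono) auto
    also have "\<dots> = exp (1/7)" using K by (simp flip: exp_of_nat_mult)
    finally have "(1 + 6 * (1 / (42 * real K))) ^ K * C \<le> exp (1/7) * (L * D)"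
      using \<open>C \<le> L * D\<close> potential_nonneg[of "grid K 0" "(x0, x0)"] grid_pos[of K 0]
      unfolding C_def by (intro mult_mono) auto
    then show "(\<integral>\<omega>. potential (grid K K) (S \<omega>) \<partial>M) \<le> exp (1/7) * (L * D)" using E by linarith
    show "0 \<le> exp (1/7) * (L * D)" unfolding D_def using L_pos by simp
    show "0 < real K powr (4/3) / 36" using K by simp
    show "real K powr (4/3) / 36 \<le> grid K K" by (rule grid_last_ge[OF K])
  qed
  also have "\<dots> = 36 * exp (1/7) * L * (norm (x0 - xstar))\<^sup>2 / real K powr (4/3)"
    unfolding D_def by simp
  finally show ?thesis using \<delta> int by blast
qed

end
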